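(* Every non-normal modal logic $L$ is sound and complete with respect to the class of bi-neighbourhood models for $L$: for every formula $A$ of $\mathcal L$, $A$ is valid in every bi-neighbourhood model for $L$ if and only if $\vdash_L A$.
   Context: The language $\mathcal L$ has formulas $A ::= p\mid\bot\mid\top\mid A\land A\mid A\lor A\mid A\to A\mid \Box A$ over countably many propositional variables, with $\neg A:=A\to\bot$ and $A\leftrightarrow B:=(A\to B)\land(B\to A)$. A non-normal modal logic $L$ is axiomatised by a complete axiomatisation of classical propositional logic in $\mathcal L$ with modus ponens, the rule RE: from $A\leftrightarrow B$ infer $\Box A\leftrightarrow\Box B$, plus any (possibly empty) selection of: M: $\Box(A\land B)\to\Box A$; C: $\Box A\land\Box B\to\Box(A\land B)$; N: $\Box\top$; T: $\Box A\to A$; D: $\neg(\Box A\land\Box\neg A)$; P: $\neg\Box\bot$; and, for any $n\ge1$, the rule RD$_n^+$: from $\neg(A_1\land\dots\land A_n)$ infer $\neg(\Box A_1\land\dots\land\Box A_n)$. A bi-neighbourhood model is $\langle\mathcal W,\mathcal N,\mathcal V\rangle$ with $\mathcal W\neq\emptyset$, $\mathcal N(w)\subseteq\mathcal P(\mathcal W)\times\mathcal P(\mathcal W)$ for each $w$, and $\mathcal V$ a valuation of propositional variables; forcing is classical on propositional connectives and $w\Vdash\Box A$ iff there is $(\alpha,\beta)\in\mathcal N(w)$ with $\alpha\subseteq[\![A]\!]\subseteq\mathcal W\setminus\beta$, where $[\![A]\!]=\{v\mid v\Vdash A\}$. $A$ is valid in a model if it is forced at every world. The bi-neighbourhood models for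 $L$ are those satisfying, for each axiom/rule X of $L$ other than RE, the condition (X) (for all $w$): (M) if $(\alpha,\beta)\in\mathcal N(w)$ then $\beta=\emptyset$; (N) there is $\alpha\subseteq\mathcal W$ with $(\alpha,\emptyset)\in\mathcal N(w)$ for all $w$; (C) if $(\alpha,\beta),(\gamma,\delta)\in\mathcal N(w)$ then $(\alpha\cap\gamma,\beta\cup\delta)\in\mathcal N(w)$; (T) if $(\alpha,\beta)\in\mathcal N(w)$ then $w\in\alpha$; (P) if $(\alpha,\beta)\in\mathcal N(w)$ then $\alpha\neq\emptyset$; (D) if $(\alpha,\beta),(\gamma,\delta)\in\mathcal N(w)$ then $\alpha\cap\gamma\neq\emptyset$ or $\beta\cap\delta\neq\emptyset$; (RD$_n^+$) if $(\alpha_1,\beta_1),\dots,(\alpha_n,\beta_n)\in\mathcal N(w)$ then $\alpha_1\cap\dots\cap\alpha_n\neq\emptyset$. *)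

theory Defs
  imports Main
begin

datatype fm =
    Var nat
  | Bot
  | Top
  | Con fm fm
  | Dis fm fm
  | Imp fm fm
  | Box fm

abbreviation Neg :: "fm \<Rightarrow> fm" where
  "Neg A \<equiv> Imp A Bot"

abbreviation Iff :: "fm \<Rightarrow> fm \<Rightarrow> fm" where
  "Iff A B \<equiv> Con (Imp A B) (Imp B A)"

text \<open>The empty conjunction is only a default value: the rules below use nonempty lists.\<close>

fun Conj :: "fm list \<Rightarrow> fm" where
  "Conj [] = Top"
| "Conj [A] = A"
| "Conj (A # B # As) = Con A (Conj (B # As))"

text \<open>
  Classical propositional logic in the modal language: all classical tautologies (with boxed
  formulas treated as atoms) are taken as axioms. Together with modus ponens this has the same
  theorems as any other complete axiomatisation.
\<close>

primrec prop_eval :: "(nat \<Rightarrow> bool) \<Rightarrow> (fm \<Rightarrow> bool) \<Rightarrow> fm \<Rightarrow> bool" where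
  "prop_eval g h (Var p) \<longleftrightarrow> g p"
| "prop_eval g h Bot \<longleftrightarrow> False"
| "prop_eval g h Top \<longleftrightarrow> True"
| "prop_eval g h (Con A B) \<longleftrightarrow> prop_eval g h A \<and> prop_eval g h B"
| "prop_eval g h (Dis A B) \<longleftrightarrow> prop_eval g h A \<or> prop_eval g h B"
| "prop_eval g h (Imp A B) \<longleftrightarrow> (prop_eval g h A \<longrightarrow> prop_eval g h B)"
| "prop_eval g h (Box A) \<longleftrightarrow> h A"

definition tautology :: "fm \<Rightarrow> bool" where
  "tautology A \<longleftrightarrow> (\<forall>g h. prop_eval g h A)"

text \<open>
  A non-normal modal logic is given by the set of the modal axioms and rules selected in addition
  to RE; \<open>RD n\<close> stands for the rule RD\<open>\<^sub>n\<^sup>+\<close>.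
\<close>

datatype modal_principle = AxM | AxC | AxN | AxT | AxD | AxP | RD nat

definition nn_logic :: "modal_principle set \<Rightarrow> bool" where
  "nn_logic L \<longleftrightarrow> (\<forall>n. RD n \<in> L \<longrightarrow> n \<ge> 1)"

inductive derivable :: "modal_principle set \<Rightarrow> fm \<Rightarrow> bool" (infix "\<turnstile>" 50)
  for L :: "modal_principle set" where
  Taut: "tautology A \<Longrightarrow> L \<turnstile> A"
| MP: "L \<turnstile> Imp A B \<Longrightarrow> L \<turnstile> A \<Longrightarrow> L \<turnstile> B"
| RE: "L \<turnstile> Iff A B \<Longrightarrow> L \<turnstile> Iff (Box A) (Box B)"
| M: "AxM \<in> L \<Longrightarrow> L \<turnstile> Imp (Box (Con A B)) (Box A)"
| C: "AxC \<in> L \<Longrightarrow> L \<turnstile> Imp (Con (Box A) (Box B)) (Box (Con A B))"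
| N: "AxN \<in> L \<Longrightarrow> L \<turnstile> Box Top"
| T: "AxT \<in> L \<Longrightarrow> L \<turnstile> Imp (Box A) A"
| D: "AxD \<in> L \<Longrightarrow> L \<turnstile> Neg (Con (Box A) (Box (Neg A)))"
| P: "AxP \<in> L \<Longrightarrow> L \<turnstile> Neg (Box Bot)"
| RDn: "RD n \<in> L \<Longrightarrow> length As = n \<Longrightarrow> L \<turnstile> Neg (Conj As)
    \<Longrightarrow> L \<turnstile> Neg (Conj (map Box As))"

record 'w bn_struct =
  worlds :: "'w set"
  nbhd :: "'w \<Rightarrow> ('w set \<times> 'w set) set"
  val :: "nat \<Rightarrow> 'w set"

definition bn_model :: "'w bn_struct \<Rightarrow> bool" where
  "bn_model M \<longleftrightarrow>
     worlds M \<noteq> {} \<and>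
     (\<forall>w \<in> worlds M. nbhd M w \<subseteq> Pow (worlds M) \<times> Pow (worlds M)) \<and>
     (\<forall>p. val M p \<subseteq> worlds M)"

primrec forces :: "'w bn_struct \<Rightarrow> fm \<Rightarrow> 'w \<Rightarrow> bool" where
  "forces M (Var p) w \<longleftrightarrow> w \<in> val M p"
| "forces M Bot w \<longleftrightarrow> False"
| "forces M Top w \<longleftrightarrow> True"
| "forces M (Con A B) w \<longleftrightarrow> forces M A w \<and> forces M B w"
| "forces M (Dis A B) w \<longleftrightarrow> forces M A w \<or> forces M B w"
| "forces M (Imp A B) w \<longleftrightarrow> (forces M A w \<longrightarrow> forces M B w)"
| "forces M (Box A) w \<longleftrightarrow>
     (\<exists>(\<alpha>, \<beta>) \<in> nbhd M w.
        \<alpha> \<subseteq> {v \<in> worlds M. forces M A v} \<and> {v \<in> worlds M. forces M A v} \<subseteq> worlds M - \<beta>)"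

definition valid_in :: "'w bn_struct \<Rightarrow> fm \<Rightarrow> bool" where
  "valid_in M A \<longleftrightarrow> (\<forall>w \<in> worlds M. forces M A w)"

fun bn_cond :: "'w bn_struct \<Rightarrow> modal_principle \<Rightarrow> bool" where
  "bn_cond M AxM \<longleftrightarrow> (\<forall>w \<in> worlds M. \<forall>\<alpha> \<beta>. (\<alpha>, \<beta>) \<in> nbhd M w \<longrightarrow> \<beta> = {})"
| "bn_cond M AxN \<longleftrightarrow> (\<exists>\<alpha>. \<alpha> \<subseteq> worlds M \<and> (\<forall>w \<in> worlds M. (\<alpha>, {}) \<in> nbhd M w))"
| "bn_cond M AxC \<longleftrightarrow> (\<forall>w \<in> worlds M. \<forall>\<alpha> \<beta> \<gamma> \<delta>.
     (\<alpha>, \<beta>) \<in> nbhd M w \<and> (\<gamma>, \<delta>) \<in> nbhd M w \<longrightarrow> (\<alpha> \<inter> \<gamma>, \<beta> \<union> \<delta>) \<in> nbhd M w)"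
| "bn_cond M AxT \<longleftrightarrow> (\<forall>w \<in> worlds M. \<forall>\<alpha> \<beta>. (\<alpha>, \<beta>) \<in> nbhd M w \<longrightarrow> w \<in> \<alpha>)"
| "bn_cond M AxP \<longleftrightarrow> (\<forall>w \<in> worlds M. \<forall>\<alpha> \<beta>. (\<alpha>, \<beta>) \<in> nbhd M w \<longrightarrow> \<alpha> \<noteq> {})"
| "bn_cond M AxD \<longleftrightarrow> (\<forall>w \<in> worlds M. \<forall>\<alpha> \<beta> \<gamma> \<delta>.
     (\<alpha>, \<beta>) \<in> nbhd M w \<and> (\<gamma>, \<delta>) \<in> nbhd M w \<longrightarrow> \<alpha> \<inter> \<gamma> \<noteq> {} \<or> \<beta> \<inter> \<delta> \<noteq> {})"
| "bn_cond M (RD n) \<longleftrightarrow> (\<forall>w \<in> worlds M. \<forall>\<alpha> \<beta>.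
     (\<forall>i \<in> {1..n}. (\<alpha> i, \<beta> i) \<in> nbhd M w) \<longrightarrow> (\<Inter>i \<in> {1..n}. \<alpha> i) \<noteq> {})"

definition bn_model_for :: "modal_principle set \<Rightarrow> 'w bn_struct \<Rightarrow> bool" where
  "bn_model_for L M \<longleftrightarrow> bn_model M \<and> (\<forall>X \<in> L. bn_cond M X)"

end

theory Submission
  imports Defs
begin

text \<open>
  Completeness uses a canonical model on the maximal consistent sets. Each \<open>Box A\<close> in a world
  \<open>w\<close> contributes the pair of the truth set of \<open>A\<close> and its complement; in the presence of M
  the second component is replaced by the empty set. Equality of truth sets is
  provable equivalence, so RE (or, with M, monotonicity) yields the truth lemma, and each condition
  on pairs reduces to the corresponding axiom or rule.
\<close>

section \<open>Soundness\<close>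

lemma forces_Conj: "forces M (Conj As) w \<longleftrightarrow> (\<forall>A \<in> set As. forces M A w)"
  by (induction As rule: Conj.induct) auto

lemma prop_eval_foldr_Imp:
  "prop_eval g h (foldr Imp As B) \<longleftrightarrow> ((\<forall>A \<in> set As. prop_eval g h A) \<longrightarrow> prop_eval g h B)"
  by (induction As) auto

text \<open>At a fixed world forcing is a classical valuation in which boxed formulas act as atoms,
  so tautologies are forced whatever the neighbourhoods are.\<close>

lemma forces_eq_prop_eval:
  "forces M A w \<longleftrightarrow> prop_eval (\<lambda>p. w \<in> val M p) (\<lambda>B. forces M (Box B) w) A"
  by (induction A) simp_all

lemma bn_model_for_cond: "bn_model_for L M \<Longrightarrow> X \<in> L \<Longrightarrow> bn_cond M X"
  by (simp only: bn_model_for_def)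

lemma soundness:
  assumes "L \<turnstile> A" and L: "nn_logic L" and model: "bn_model_for L M"
  shows "valid_in M A"
  using assms(1)
proof (induction rule: derivable.induct)
  case (Taut A)
  then show ?case
    by (simp add: valid_in_def tautology_def forces_eq_prop_eval[of M A])
next
  case (MP A B)
  then show ?case by (simp add: valid_in_def)
next
  case (RE A B)
  then have "{v \<in> worlds M. forces M A v} = {v \<in> worlds M. forces M B v}"
    by (auto simp: valid_in_def)
  then show ?case by (simp add: valid_in_def)
next
  case (M A B)
  then have m: "bn_cond M AxM" by (rule bn_model_for_cond[OF model])
  show ?case unfolding valid_in_def
  proof (clarsimp)
    fix w \<alpha> \<beta>
    assume "w \<in> worlds M" and ab: "(\<alpha>, \<beta>) \<in> nbhd M w"
      and sub: "\<alpha> \<subseteq> {v \<in> worlds M. forces M A v \<and> forces M B v}"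
    \<comment> \<open>With an empty second component the upper bound is vacuous, so the same pair
      supports the weaker formula \<open>A\<close>.\<close>
    then have "\<beta> = {}" using m by simp
    then show "\<exists>x\<in>nbhd M w. case x of (\<alpha>, \<beta>) \<Rightarrow>
        \<alpha> \<subseteq> {v \<in> worlds M. forces M A v} \<and> {v \<in> worlds M. forces M A v} \<subseteq> worlds M - \<beta>"
      using ab sub by (intro bexI[of _ "(\<alpha>, \<beta>)"]) auto
  qed
next
  case (C A B)
  then have c: "bn_cond M AxC" by (rule bn_model_for_cond[OF model])
  show ?case unfolding valid_in_def
  proof (clarsimp)
    fix w \<alpha> \<beta> \<gamma> \<delta>
    assume w: "w \<in> worlds M" "(\<alpha>, \<beta>) \<in> nbhd M w" "(\<gamma>, \<delta>) \<in> nbhd M w"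
      and "\<alpha> \<subseteq> {v \<in> worlds M. forces M A v}" "{v \<in> worlds M. forces M A v} \<subseteq> worlds M - \<beta>"
        "\<gamma> \<subseteq> {v \<in> worlds M. forces M B v}" "{v \<in> worlds M. forces M B v} \<subseteq> worlds M - \<delta>"
    moreover have "(\<alpha> \<inter> \<gamma>, \<beta> \<union> \<delta>) \<in> nbhd M w" using c w by simp
    ultimately show "\<exists>x\<in>nbhd M w. case x of (\<alpha>, \<beta>) \<Rightarrow>
        \<alpha> \<subseteq> {v \<in> worlds M. forces M A v \<and> forces M B v} \<and>
        {v \<in> worlds M. forces M A v \<and> forces M B v} \<subseteq> worlds M - \<beta>"
      by (intro bexI[of _ "(\<alpha> \<inter> \<gamma>, \<beta> \<union> \<delta>)"]) auto
  qed
next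
  case N
  then have "bn_cond M AxN" by (rule bn_model_for_cond[OF model])
  then obtain \<alpha> where "\<alpha> \<subseteq> worlds M" "\<forall>w \<in> worlds M. (\<alpha>, {}) \<in> nbhd M w" by auto
  then show ?case by (auto simp: valid_in_def intro!: bexI[of _ "(\<alpha>, {})"])
next
  case (T A)
  then have "bn_cond M AxT" by (rule bn_model_for_cond[OF model])
  then show ?case by (fastforce simp: valid_in_def)
next
  case (D A)
  then have d: "bn_cond M AxD" by (rule bn_model_for_cond[OF model])
  show ?case unfolding valid_in_def
  proof (clarsimp)
    fix w \<alpha> \<beta> \<gamma> \<delta>
    assume w: "w \<in> worlds M" "(\<alpha>, \<beta>) \<in> nbhd M w" "(\<gamma>, \<delta>) \<in> nbhd M w"
      and sub: "\<alpha> \<subseteq> {v \<in> worlds M. forces M A v}" "{v \<in> worlds M. forces M A v} \<subseteq> worlds M - \<beta>"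
        "\<gamma> \<subseteq> {v \<in> worlds M. \<not> forces M A v}" "{v \<in> worlds M. \<not> forces M A v} \<subseteq> worlds M - \<delta>"
    \<comment> \<open>A point of both \<beta> and \<delta> lies in neither truth set, hence outside
      the worlds; this inclusion excludes such points.\<close>
    have "\<beta> \<subseteq> worlds M"
      using model w unfolding bn_model_for_def bn_model_def by blast
    then have "\<alpha> \<inter> \<gamma> = {}" "\<beta> \<inter> \<delta> = {}" using sub by blast+
    then show False using d w by auto
  qed
next
  case P
  then have "bn_cond M AxP" by (rule bn_model_for_cond[OF model])
  then show ?case by (fastforce simp: valid_in_def)
next
  case (RDn n As)
  have c: "bn_cond M (RD n)" using RDn.hyps(1) by (rule bn_model_for_cond[OF model])
  have n: "n \<ge> 1" using L RDn by (simp add: nn_logic_def)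
  have "\<not> forces M (Conj (map Box As)) w" if w: "w \<in> worlds M" for w
  proof
    assume "forces M (Conj (map Box As)) w"
    \<comment> \<open>The condition counts pairs from 1 and list positions start at 0: hence
      \<open>i - 1\<close> here and \<open>Suc j\<close> below.\<close>
    then have "\<forall>i \<in> {1..n}. forces M (Box (As ! (i - 1))) w"
      using RDn.hyps(2) by (auto simp: forces_Conj simp del: forces.simps)
    then have "\<forall>i \<in> {1..n}. \<exists>\<alpha> \<beta>. (\<alpha>, \<beta>) \<in> nbhd M w
        \<and> \<alpha> \<subseteq> {v \<in> worlds M. forces M (As ! (i - 1)) v}"
      by fastforce
    then obtain \<alpha> \<beta> where ab: "\<forall>i \<in> {1..n}. (\<alpha> i, \<beta> i) \<in> nbhd M w
        \<and> \<alpha> i \<subseteq> {v \<in> worlds M. forces M (As ! (i - 1)) v}"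
      by metis
    then have "(\<Inter>i \<in> {1..n}. \<alpha> i) \<noteq> {}" using c w unfolding bn_cond.simps by blast
    \<comment> \<open>A common point of all \<open>\<alpha> i\<close> forces every member of
      \<open>As\<close>, against the induction hypothesis. It is a world because n \<ge> 1 provides
      at least one \<open>\<alpha> i\<close>, which lies inside the worlds.\<close>
    then obtain v where v: "\<forall>i \<in> {1..n}. v \<in> \<alpha> i" by auto
    have "v \<in> worlds M" using v ab n by fastforce
    moreover have "forces M (As ! j) v" if "j < n" for j
      using v ab that by (auto dest!: bspec[of _ _ "Suc j"])
    then have "forces M (Conj As) v"
      using RDn.hyps(2) by (auto simp: forces_Conj in_set_conv_nth)
    ultimately show False using RDn.IH by (simp add: valid_in_def)
  qed
  then show ?case by (simp add: valid_in_def)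
qed

section \<open>Derivability from hypotheses\<close>

lemma derivable_foldr_Imp:
  "L \<turnstile> foldr Imp As B \<Longrightarrow> \<forall>A \<in> set As. L \<turnstile> A \<Longrightarrow> L \<turnstile> B"
  by (induction As) (auto dest: MP)

text \<open>The chain of implications from \<open>As\<close> to \<open>B\<close> is a tautology,
  hence an axiom, and MP discharges the premises. Truth tables thus replace explicit
  derivations.\<close>

lemma derivable_prop_consequence:
  assumes "\<And>g h. \<forall>A \<in> set As. prop_eval g h A \<Longrightarrow> prop_eval g h B"
    and "\<forall>A \<in> set As. L \<turnstile> A"
  shows "L \<turnstile> B"
proof (rule derivable_foldr_Imp[OF Taut])
  show "tautology (foldr Imp As B)"
    using assms(1) by (auto simp: tautology_def prop_eval_foldr_Imp)
qed (fact assms(2))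

text \<open>Hypotheses enter only as antecedents of a theorem, so RE and \<open>RDn\<close> are
  never applied to them, and each deduction uses finitely many.\<close>

definition deducible :: "modal_principle set \<Rightarrow> fm set \<Rightarrow> fm \<Rightarrow> bool" where
  "deducible L S A \<longleftrightarrow> (\<exists>As. set As \<subseteq> S \<and> L \<turnstile> foldr Imp As A)"

lemma deducible_empty: "deducible L {} A \<longleftrightarrow> L \<turnstile> A"
  by (auto simp: deducible_def)

lemma deducible_assumption: "A \<in> S \<Longrightarrow> deducible L S A"
  unfolding deducible_def
  by (intro exI[of _ "[A]"]) (auto intro!: Taut simp: tautology_def)

text \<open>Concatenating the hypothesis lists of all premises gives a single list from which every
  premise follows; the rest is propositional.\<close>

lemma deducible_prop_consequence:
  assumes taut: "\<And>g h. \<forall>A \<in> set As. prop_eval g h A \<Longrightarrow> prop_eval g h B"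
    and As: "\<forall>A \<in> set As. deducible L S A"
  shows "deducible L S B"
proof -
  obtain F where F: "\<forall>A \<in> set As. set (F A) \<subseteq> S \<and> L \<turnstile> foldr Imp (F A) A"
    using As unfolding deducible_def by metis
  have "L \<turnstile> foldr Imp (concat (map F As)) B"
  proof (rule derivable_prop_consequence[of "map (\<lambda>A. foldr Imp (F A) A) As"])
    show "prop_eval g h (foldr Imp (concat (map F As)) B)"
      if "\<forall>C \<in> set (map (\<lambda>A. foldr Imp (F A) A) As). prop_eval g h C" for g h
      using that taut[of g h] by (auto simp: prop_eval_foldr_Imp)
  qed (use F in auto)
  moreover have "set (concat (map F As)) \<subseteq> S" using F by auto
  ultimately show ?thesis unfolding deducible_def by blast
qed

lemma deduction_theorem:
  assumes "deducible L (insert A S) B"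
  shows "deducible L S (Imp A B)"
proof -
  obtain As where As: "set As \<subseteq> insert A S" "L \<turnstile> foldr Imp As B"
    using assms unfolding deducible_def by blast
  let ?Bs = "filter (\<lambda>C. C \<noteq> A) As"
  have "L \<turnstile> foldr Imp ?Bs (Imp A B)"
    by (rule derivable_prop_consequence[of "[foldr Imp As B]"])
      (use As in \<open>auto simp: prop_eval_foldr_Imp\<close>)
  moreover have "set ?Bs \<subseteq> S" using As by auto
  ultimately show ?thesis unfolding deducible_def by blast
qed

section \<open>Maximal consistent sets\<close>

definition mcs :: "modal_principle set \<Rightarrow> fm set set" where
  "mcs L = {w. \<not> deducible L w Bot \<and> (\<forall>A. A \<in> w \<or> Neg A \<in> w)}"

text \<open>Zorn's lemma on the consistent extensions of \<open>S\<close>: an inconsistency uses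
  finitely many formulas, so unions of chains stay consistent, and a maximal element decides every
  formula.\<close>

lemma lindenbaum:
  assumes "\<not> deducible L S Bot"
  shows "\<exists>w \<in> mcs L. S \<subseteq> w"
proof -
  let ?\<A> = "{w. S \<subseteq> w \<and> \<not> deducible L w Bot}"
  have "\<exists>m \<in> ?\<A>. \<forall>w \<in> ?\<A>. m \<subseteq> w \<longrightarrow> w = m"
  proof (rule subset_Zorn_nonempty)
    show "?\<A> \<noteq> {}" using assms by blast
  next
    fix \<C> assume \<C>: "\<C> \<noteq> {}" "subset.chain ?\<A> \<C>"
    have "\<not> deducible L (\<Union>\<C>) Bot"
    proof
      assume "deducible L (\<Union>\<C>) Bot"
      then obtain As where As: "set As \<subseteq> \<Union>\<C>" "L \<turnstile> foldr Imp As Bot"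
        unfolding deducible_def by blast
      then obtain w where "w \<in> \<C>" "set As \<subseteq> w"
        using finite_subset_Union_chain[OF _ As(1) \<C>] by auto
      then show False using As \<C> unfolding deducible_def subset.chain_def by blast
    qed
    then show "\<Union>\<C> \<in> ?\<A>" using \<C> unfolding subset.chain_def by blast
  qed
  then obtain m where "m \<in> ?\<A>" and m_max: "\<forall>w \<in> ?\<A>. m \<subseteq> w \<longrightarrow> w = m" ..
  then have m: "S \<subseteq> m" "\<not> deducible L m Bot" by simp_all
  have max: "w = m" if "m \<subseteq> w" "\<not> deducible L w Bot" for w
    using m_max m(1) that by simp
  have "A \<in> m \<or> Neg A \<in> m" for A
  proof (rule ccontr)
    assume "\<not> (A \<in> m \<or> Neg A \<in> m)"
    \<comment> \<open>Both extensions are proper, hence inconsistent by maximality; the deduction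
      theorem then makes \<open>m\<close> refute \<open>A\<close> as well as
      \<open>Neg A\<close>.\<close>
    then have "deducible L (insert A m) Bot" "deducible L (insert (Neg A) m) Bot"
      using max by blast+
    then have "deducible L m (Neg A)" "deducible L m (Neg (Neg A))"
      using deduction_theorem by blast+
    then have "deducible L m Bot"
      by (intro deducible_prop_consequence[of "[Neg A, Neg (Neg A)]"]) auto
    then show False using m by blast
  qed
  then show ?thesis using m by (auto simp: mcs_def)
qed

text \<open>Deductive closure: a deducible formula outside \<open>w\<close> would have its negation
  in \<open>w\<close>, making \<open>w\<close> inconsistent.\<close>

lemma mcs_deducible_iff:
  assumes "w \<in> mcs L"
  shows "A \<in> w \<longleftrightarrow> deducible L w A"
proof
  assume "deducible L w A"
  moreover have "\<not> deducible L w Bot" using assms by (simp add: mcs_def)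
  ultimately have "\<not> deducible L w (Neg A)"
    using deducible_prop_consequence[of "[A, Neg A]" Bot L w] by auto
  then show "A \<in> w" using assms deducible_assumption by (auto simp: mcs_def)
qed (rule deducible_assumption)

text \<open>Reduces the membership laws for the connectives to truth tables.\<close>

lemma mcs_prop_consequence:
  assumes "w \<in> mcs L" "set As \<subseteq> w"
    and "\<And>g h. \<forall>A \<in> set As. prop_eval g h A \<Longrightarrow> prop_eval g h B"
  shows "B \<in> w"
  using assms deducible_prop_consequence[of As B L w] mcs_deducible_iff by blast

lemma mcs_derivable: "w \<in> mcs L \<Longrightarrow> L \<turnstile> A \<Longrightarrow> A \<in> w"
  using mcs_deducible_iff[of w L A]
  by (auto simp: deducible_def intro: exI[of _ "[]"])

lemma mcs_Bot: "w \<in> mcs L \<Longrightarrow> Bot \<notin> w"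
  using mcs_deducible_iff[of w L Bot] by (simp add: mcs_def)

text \<open>If \<open>A\<close> is not derivable, then \<open>{Neg A}\<close> is consistent, and a
  maximal consistent extension of it omits \<open>A\<close>.\<close>

lemma derivable_iff_mcs: "L \<turnstile> A \<longleftrightarrow> (\<forall>w \<in> mcs L. A \<in> w)"
proof
  assume all: "\<forall>w \<in> mcs L. A \<in> w"
  have "deducible L {Neg A} Bot"
  proof (rule ccontr)
    assume "\<not> deducible L {Neg A} Bot"
    then obtain w where w: "w \<in> mcs L" "Neg A \<in> w" using lindenbaum by blast
    then have "Bot \<in> w"
      using all by (intro mcs_prop_consequence[of w L "[A, Neg A]"]) auto
    then show False using w mcs_Bot by blast
  qed
  then have "L \<turnstile> Neg (Neg A)"
    using deduction_theorem[of L "Neg A" "{}"] by (simp add: deducible_empty)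
  then show "L \<turnstile> A"
    by (intro derivable_prop_consequence[of "[Neg (Neg A)]"]) auto
qed (auto intro: mcs_derivable)

lemma mcs_Top: "w \<in> mcs L \<Longrightarrow> Top \<in> w"
  by (rule mcs_prop_consequence[of _ _ "[]"]) auto

lemma mcs_Neg: "w \<in> mcs L \<Longrightarrow> Neg A \<in> w \<longleftrightarrow> A \<notin> w"
  using mcs_prop_consequence[of w L "[A, Neg A]" Bot] mcs_Bot[of w L] by (auto simp: mcs_def)

lemma mcs_Con:
  assumes "w \<in> mcs L"
  shows "Con A B \<in> w \<longleftrightarrow> A \<in> w \<and> B \<in> w"
proof -
  have "A \<in> w" if "Con A B \<in> w"
    by (rule mcs_prop_consequence[OF assms, of "[Con A B]"]) (use that in auto)
  moreover have "B \<in> w" if "Con A B \<in> w"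
    by (rule mcs_prop_consequence[OF assms, of "[Con A B]"]) (use that in auto)
  moreover have "Con A B \<in> w" if "A \<in> w" "B \<in> w"
    by (rule mcs_prop_consequence[OF assms, of "[A, B]"]) (use that in auto)
  ultimately show ?thesis by blast
qed

lemma mcs_Dis:
  assumes "w \<in> mcs L"
  shows "Dis A B \<in> w \<longleftrightarrow> A \<in> w \<or> B \<in> w"
proof -
  have "Dis A B \<in> w" if "A \<in> w"
    by (rule mcs_prop_consequence[OF assms, of "[A]"]) (use that in auto)
  moreover have "Dis A B \<in> w" if "B \<in> w"
    by (rule mcs_prop_consequence[OF assms, of "[B]"]) (use that in auto)
  moreover have "B \<in> w" if "Dis A B \<in> w" "Neg A \<in> w"
    by (rule mcs_prop_consequence[OF assms, of "[Dis A B, Neg A]"]) (use that in auto)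
  ultimately show ?thesis using mcs_Neg[OF assms, of A] by blast
qed

lemma mcs_Imp:
  assumes "w \<in> mcs L"
  shows "Imp A B \<in> w \<longleftrightarrow> (A \<in> w \<longrightarrow> B \<in> w)"
proof -
  have "B \<in> w" if "Imp A B \<in> w" "A \<in> w"
    by (rule mcs_prop_consequence[OF assms, of "[Imp A B, A]"]) (use that in auto)
  moreover have "Imp A B \<in> w" if "Neg A \<in> w"
    by (rule mcs_prop_consequence[OF assms, of "[Neg A]"]) (use that in auto)
  moreover have "Imp A B \<in> w" if "B \<in> w"
    by (rule mcs_prop_consequence[OF assms, of "[B]"]) (use that in auto)
  ultimately show ?thesis using mcs_Neg[OF assms, of A] by blast
qed

lemmas mcs_simps = mcs_Bot mcs_Top mcs_Con mcs_Dis mcs_Imp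

lemma mcs_Conj: "w \<in> mcs L \<Longrightarrow> Conj As \<in> w \<longleftrightarrow> (\<forall>A \<in> set As. A \<in> w)"
  by (induction As rule: Conj.induct) (auto simp: mcs_simps)

section \<open>Truth sets and boxed formulas\<close>

definition truth_set :: "modal_principle set \<Rightarrow> fm \<Rightarrow> fm set set" where
  "truth_set L A = {w \<in> mcs L. A \<in> w}"

text \<open>Lets the premise of RE be checked as an equality of sets.\<close>

lemma truth_set_eq_iff: "truth_set L A = truth_set L B \<longleftrightarrow> L \<turnstile> Iff A B"
  by (auto simp: truth_set_def derivable_iff_mcs mcs_simps)

lemma truth_set_subset_mcs: "truth_set L A \<subseteq> mcs L"
  by (auto simp: truth_set_def)

lemma mcs_Box_cong:
  assumes "w \<in> mcs L" "truth_set L A = truth_set L B" "Box A \<in> w"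
  shows "Box B \<in> w"
  using assms mcs_derivable[OF assms(1) RE[of L A B]]
  by (simp add: truth_set_eq_iff mcs_simps)

lemma mcs_Box_mono:
  assumes "AxM \<in> L" "w \<in> mcs L" "truth_set L A \<subseteq> truth_set L B" "Box A \<in> w"
  shows "Box B \<in> w"
proof -
  \<comment> \<open>The inclusion makes \<open>A\<close> equivalent to \<open>Con B A\<close>; RE
    carries the box over, and M then keeps the conjunct \<open>B\<close>.\<close>
  have "truth_set L A = truth_set L (Con B A)"
    using assms(3) by (auto simp: truth_set_def mcs_simps)
  then have "Box (Con B A) \<in> w" using assms mcs_Box_cong by blast
  then show ?thesis
    using mcs_derivable[OF assms(2) M[OF assms(1), of B A]] assms(2) by (simp add: mcs_simps)
qed

section \<open>The canonical model\<close>

definition canonical_pair :: "modal_principle set \<Rightarrow> fm \<Rightarrow> fm set set \<times> fm set set" where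
  "canonical_pair L A = (truth_set L A, if AxM \<in> L then {} else mcs L - truth_set L A)"

definition canonical :: "modal_principle set \<Rightarrow> fm set bn_struct" where
  "canonical L = \<lparr>worlds = mcs L, nbhd = (\<lambda>w. canonical_pair L ` {A. Box A \<in> w}),
     val = (\<lambda>p. truth_set L (Var p))\<rparr>"

lemma canonical_simps [simp]:
  "worlds (canonical L) = mcs L"
  "nbhd (canonical L) w = canonical_pair L ` {A. Box A \<in> w}"
  "val (canonical L) p = truth_set L (Var p)"
  by (simp_all add: canonical_def)

lemma truth_lemma: "w \<in> mcs L \<Longrightarrow> forces (canonical L) A w \<longleftrightarrow> A \<in> w"
proof (induction A arbitrary: w)
  case (Box A)
  have ts: "{v \<in> mcs L. forces (canonical L) A v} = truth_set L A"
    using Box.IH by (auto simp: truth_set_def)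
  \<comment> \<open>The upper bound given by the pair of \<open>B\<close> amounts to the reverse
    inclusion of truth sets; under M it imposes nothing.\<close>
  have "truth_set L A \<subseteq> mcs L - (if AxM \<in> L then {} else mcs L - truth_set L B) \<longleftrightarrow>
      AxM \<in> L \<or> truth_set L A \<subseteq> truth_set L B" for B
    using truth_set_subset_mcs[of L A] by auto
  then have "forces (canonical L) (Box A) w \<longleftrightarrow>
      (\<exists>B. Box B \<in> w \<and> truth_set L B \<subseteq> truth_set L A \<and>
        (AxM \<in> L \<or> truth_set L A \<subseteq> truth_set L B))"
    by (simp add: ts canonical_pair_def)
  \<comment> \<open>Without M the two inclusions give equality and RE applies; with M the first
    alone suffices by monotonicity. Conversely, \<open>A\<close> itself serves as
    \<open>B\<close>.\<close>
  also have "\<dots> \<longleftrightarrow> Box A \<in> w"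
    using mcs_Box_mono mcs_Box_cong Box.prems by blast
  finally show ?case .
qed (auto simp: mcs_simps truth_set_def)

lemma canonical_cond:
  assumes X: "X \<in> L"
  shows "bn_cond (canonical L) X"
proof (cases X)
  case AxM
  then show ?thesis using X by (auto simp: canonical_pair_def)
next
  case AxC
  have "Box (Con A B) \<in> w" if "w \<in> mcs L" "Box A \<in> w" "Box B \<in> w" for w A B
    using that mcs_derivable[OF that(1) C[of L A B]] X AxC by (simp add: mcs_simps)
  \<comment> \<open>The second components agree by De Morgan's law; under M all of them are
    empty.\<close>
  moreover have "canonical_pair L (Con A B) =
      (truth_set L A \<inter> truth_set L B, snd (canonical_pair L A) \<union> snd (canonical_pair L B))" for A B
    unfolding canonical_pair_def truth_set_def by (simp add: mcs_Con cong: conj_cong) blast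
  ultimately have "(\<alpha> \<inter> \<gamma>, \<beta> \<union> \<delta>) \<in> nbhd (canonical L) w"
    if "w \<in> mcs L" "(\<alpha>, \<beta>) = canonical_pair L A" "Box A \<in> w"
      "(\<gamma>, \<delta>) = canonical_pair L B" "Box B \<in> w" for w \<alpha> \<beta> \<gamma> \<delta> A B
    using that by (auto simp: canonical_pair_def intro!: image_eqI[of _ _ "Con A B"])
  then show ?thesis unfolding AxC bn_cond.simps by auto
next
  case AxN
  \<comment> \<open>The complement of the truth set of \<open>Top\<close> is already empty, so the
    pair has this shape with or without M.\<close>
  have "canonical_pair L Top = (mcs L, {})"
    by (auto simp: canonical_pair_def truth_set_def mcs_simps)
  moreover have "Box Top \<in> w" if "w \<in> mcs L" for w
    using mcs_derivable[OF that N] X AxN by simp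
  ultimately show ?thesis using AxN by (auto simp: image_iff intro!: exI[of _ "mcs L"] exI[of _ Top])
next
  case AxT
  have "A \<in> w" if "w \<in> mcs L" "Box A \<in> w" for w A
    using that mcs_derivable[OF that(1) T[of L A]] X AxT by (simp add: mcs_simps)
  then show ?thesis using AxT by (auto simp: canonical_pair_def truth_set_def)
next
  case AxD
  have "truth_set L A \<inter> truth_set L B \<noteq> {} \<or>
      snd (canonical_pair L A) \<inter> snd (canonical_pair L B) \<noteq> {}"
    if w: "w \<in> mcs L" "Box A \<in> w" "Box B \<in> w" for w A B
  proof (rule ccontr)
    assume disj: "\<not> ?thesis"
    \<comment> \<open>The aim is \<open>Box (Neg A)\<close> in \<open>w\<close> beside
      \<open>Box A\<close>, against D. Under M this inclusion is enough.\<close>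
    have sub: "truth_set L B \<subseteq> truth_set L (Neg A)"
      using disj by (auto simp: truth_set_def mcs_simps)
    have "Box (Neg A) \<in> w"
    proof (cases "AxM \<in> L")
      case True
      then show ?thesis using mcs_Box_mono sub w by blast
    next
      case False
      \<comment> \<open>Disjoint complements supply the reverse inclusion, so \<open>B\<close> is
        equivalent to \<open>Neg A\<close> and RE replaces monotonicity.\<close>
      then have "(mcs L - truth_set L A) \<inter> (mcs L - truth_set L B) = {}"
        using disj by (simp add: canonical_pair_def)
      moreover have "truth_set L (Neg A) = mcs L - truth_set L A"
        by (auto simp: truth_set_def mcs_Neg)
      ultimately have "truth_set L (Neg A) \<subseteq> truth_set L B" by blast
      then show ?thesis using mcs_Box_cong sub w by blast
    qed
    then show False
      using w mcs_derivable[OF w(1) D[of L A]] X AxD by (simp add: mcs_simps)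
  qed
  then show ?thesis using AxD by (fastforce simp: canonical_pair_def)
next
  case AxP
  have "truth_set L A \<noteq> {}" if w: "w \<in> mcs L" "Box A \<in> w" for w A
  proof
    assume "truth_set L A = {}"
    \<comment> \<open>An empty truth set is that of \<open>Bot\<close>, so RE turns
      \<open>Box A\<close> into \<open>Box Bot\<close>, which P forbids.\<close>
    then have "truth_set L A = truth_set L Bot" by (auto simp: truth_set_def mcs_simps)
    then have "Box Bot \<in> w" using mcs_Box_cong w by blast
    then show False
      using w mcs_derivable[OF w(1) P[of L]] X AxP by (simp add: mcs_simps)
  qed
  then show ?thesis using AxP by (auto simp: canonical_pair_def)
next
  case (RD n)
  have "(\<Inter>i \<in> {1..n}. \<alpha> i) \<noteq> {}"
    if w: "w \<in> mcs L" and ab: "\<forall>i \<in> {1..n}. (\<alpha> i, \<beta> i) \<in> nbhd (canonical L) w" for w \<alpha> \<beta>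
  proof
    assume empty: "(\<Inter>i \<in> {1..n}. \<alpha> i) = {}"
    have "\<forall>i \<in> {1..n}. \<exists>A. Box A \<in> w \<and> \<alpha> i = truth_set L A"
      using ab by (fastforce simp: canonical_pair_def)
    then obtain F where F: "\<forall>i \<in> {1..n}. Box (F i) \<in> w \<and> \<alpha> i = truth_set L (F i)"
      by metis
    \<comment> \<open>The upper bound of the list interval is exclusive, so \<open>As\<close> lists
      \<open>F 1\<close> up to \<open>F n\<close>.\<close>
    define As where "As = map F [1..<Suc n]"
    have As: "set As = F ` {1..n}" "length As = n"
      unfolding As_def by auto
    \<comment> \<open>By the empty intersection every maximal consistent set omits some
      \<open>F i\<close>, hence refutes the conjunction. The rule then refutes the conjunction of
      the boxed formulas, all of which are in \<open>w\<close>.\<close>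
    have "L \<turnstile> Neg (Conj As)"
      unfolding derivable_iff_mcs
    proof
      fix v assume v: "v \<in> mcs L"
      obtain i where "i \<in> {1..n}" "v \<notin> \<alpha> i" using empty by blast
      then have "F i \<notin> v" "F i \<in> set As" using F v As by (auto simp: truth_set_def)
      then show "Neg (Conj As) \<in> v" using v by (auto simp: mcs_Neg mcs_Conj)
    qed
    then have "Neg (Conj (map Box As)) \<in> w"
      using RDn[of n L As] As X RD mcs_derivable w by blast
    moreover have "Conj (map Box As) \<in> w"
      using F As w by (auto simp: mcs_Conj)
    ultimately show False using w by (simp add: mcs_Neg)
  qed
  then show ?thesis using RD by simp
qed

section \<open>Completeness\<close>

lemma canonical_model_for:
  assumes "mcs L \<noteq> {}"
  shows "bn_model_for L (canonical L)"
proof -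
  have "canonical_pair L A \<in> Pow (mcs L) \<times> Pow (mcs L)" for A
    using truth_set_subset_mcs[of L A] by (simp add: canonical_pair_def)
  then have "bn_model (canonical L)"
    using assms truth_set_subset_mcs by (simp add: bn_model_def image_subset_iff)
  then show ?thesis using canonical_cond by (simp only: bn_model_for_def) blast
qed

text \<open>A HOL formula cannot quantify over types. The equivalence is therefore stated over
  \<open>fm set\<close>, the type of the canonical worlds, and soundness also over an arbitrary type
  \<open>'w\<close>.\<close>

theorem mainTheorem4:
  fixes L :: "modal_principle set" and A :: fm
  assumes "nn_logic L"
  shows "((\<forall>M :: fm set bn_struct. bn_model_for L M \<longrightarrow> valid_in M A) \<longleftrightarrow> L \<turnstile> A) \<and>
         (L \<turnstile> A \<longrightarrow> (\<forall>M :: 'w bn_struct. bn_model_for L M \<longrightarrow> valid_in M A))"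
proof -
  have "L \<turnstile> A" if "\<forall>M :: fm set bn_struct. bn_model_for L M \<longrightarrow> valid_in M A"
    unfolding derivable_iff_mcs
  proof
    fix w assume w: "w \<in> mcs L"
    \<comment> \<open>The given \<open>w\<close> itself witnesses that the canonical model has a
      world.\<close>
    then have "valid_in (canonical L) A" using that canonical_model_for by blast
    then show "A \<in> w" using w truth_lemma by (auto simp: valid_in_def)
  qed
  then show ?thesis
    using soundness[OF _ assms, where ?'a = "fm set"] soundness[OF _ assms, where ?'a = 'w] by blast
qed

end
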